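(* Let $t\ge 2$ be an integer and consider the P\'olya urn with $d=1$ started with $t-1$ red balls and $1$ black ball. Then $q_-(t)=\mathbf{P}(S_{t-1,1}>(t-1)/t)$ satisfies $$q_-(t)=(t-1)\sum_{n=0}^\infty\frac{(nt)!}{(nt-n+1)!}\,\frac{((n+1)(t-1))!}{((n+1)t)!}.$$
   Context: P\'olya's urn with $d=1$ and integer parameters $r,b\ge 1$: the urn initially contains $r$ red and $b$ black balls. In each draw one ball is taken uniformly at random from the urn, and this ball together with one more ball of the same color is put into the urn. $R_n$ is the number of red balls after the $n$th draw ($R_0=r$), $Z_n=R_n/(n+r+b)$, and $S_{r,b}=\sup_{n\ge 0}Z_n$. *)

theory Defs
  imports "HOL-Probability.Probability"
begin

text \<open>
  The history of an urn is recorded as a sequence of colours: \<open>c i\<close> holds iff the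
  ball taken in the \<open>(i+1)\<close>-st draw is red. Each draw adds one ball of the drawn colour.
\<close>

primrec red_balls :: "nat \<Rightarrow> (nat \<Rightarrow> bool) \<Rightarrow> nat \<Rightarrow> nat" where
  "red_balls r c 0 = r"
| "red_balls r c (Suc n) = red_balls r c n + (if c n then 1 else 0)"

definition red_fraction :: "nat \<Rightarrow> nat \<Rightarrow> (nat \<Rightarrow> bool) \<Rightarrow> nat \<Rightarrow> real" where
  "red_fraction r b c n = real (red_balls r c n) / real (n + r + b)"

text \<open>The fractions lie in \<open>[0, 1]\<close>, so the following supremum is a genuine one.\<close>

definition sup_red_fraction :: "nat \<Rightarrow> nat \<Rightarrow> (nat \<Rightarrow> bool) \<Rightarrow> real" where
  "sup_red_fraction r b c = (SUP n. red_fraction r b c n)"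

text \<open>
  \<open>D n \<omega>\<close> tells whether draw \<open>n + 1\<close> is red. A ball taken uniformly at random from an
  urn with \<open>n + r + b\<close> balls is red with probability the current fraction of red balls;
  this is required conditionally on every possible outcome \<open>h\<close> of the first \<open>n\<close> draws.
  Only \<open>h 0, \<dots>, h (n - 1)\<close> matter in \<open>draw\<close>.
\<close>

locale polya_urn = prob_space M
  for M :: "'a measure" and D :: "nat \<Rightarrow> 'a \<Rightarrow> bool" and r b :: nat +
  assumes red_pos: "r \<ge> 1" and black_pos: "b \<ge> 1"
    and measurable_draw: "\<And>n. D n \<in> measurable M (count_space UNIV)"
    and draw: "\<And>n h. \<P>(\<omega> in M. \<forall>i<n. D i \<omega> = h i) > 0 \<Longrightarrow>
      \<P>(\<omega> in M. D n \<omega> \<bar> \<forall>i<n. D i \<omega> = h i) = red_fraction r b h n"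

end

theory Submission
  imports Defs
begin

text \<open>
  Put \<open>d = t - 1\<close>. The urn starts with \<open>d\<close> red and one black ball, so the red fraction starts at
  \<open>d / (d + 1)\<close>, and it exceeds this value iff the number of red balls exceeds \<open>d\<close> times the number
  of black balls. This difference is a walk that starts at \<open>0\<close>, goes up by \<open>1\<close> at a red draw and down
  by \<open>d\<close> at a black one. Hence the supremum exceeds \<open>d / (d + 1)\<close> iff the walk ever hits \<open>1\<close>, and,
  its upward steps being \<open>1\<close>, it must hit \<open>1\<close> exactly. If it first does so after \<open>k\<close> black draws, then
  it does so after \<open>1 + d k\<close> red ones, that is at time \<open>k t + 1\<close>. The events for different \<open>k\<close> are
  disjoint, so by countable additivity the series of their probabilities converges, and its sum is
  the probability sought.

  The draws are exchangeable: the probability of an outcome of the first \<open>n\<close> draws depends only on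
  its numbers of red and black draws, and is a quotient of rising factorials (\<open>prob_cylinder\<close>). So
  the \<open>k\<close>-th event has this probability times the number of walks that first hit \<open>1\<close> after
  \<open>k\<close> downward steps. More generally, from distance \<open>s\<close> below the target the number is

    \<open>s / (s + (d + 1) k)\<close> times the binomial coefficient of \<open>s + (d + 1) k\<close> over \<open>k\<close>,

  a Raney number. Allowing an arbitrary distance \<open>s\<close> makes it possible to
  prove this by conditioning on the first step (\<open>card_first_passage_words\<close>).
\<close>

section \<open>First-passage words\<close>

text \<open>
  A word of draws is read as a walk, and \<open>s\<close> is the distance still to climb: a red draw (\<open>True\<close>)
  reduces it by one, a black draw increases it by \<open>d\<close>. The word has to end at the moment when the
  distance first becomes \<open>0\<close>.
\<close>

fun first_passage :: "nat \<Rightarrow> nat \<Rightarrow> bool list \<Rightarrow> bool" where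
  "first_passage d s [] \<longleftrightarrow> s = 0"
| "first_passage d 0 (c # w) \<longleftrightarrow> False"
| "first_passage d (Suc s) (c # w) \<longleftrightarrow> first_passage d (if c then s else Suc s + d) w"

lemma first_passage_0_iff [simp]: "first_passage d 0 w \<longleftrightarrow> w = []"
  by (cases w) auto

lemma first_passage_count:
  "first_passage d s w \<Longrightarrow> count_list w True = s + d * count_list w False"
  by (induction d s w rule: first_passage.induct) (auto split: if_splits)

text \<open>
  First-passage words are prefix-free, so that a sequence of draws has at most one first passage.
\<close>

lemma first_passage_append_eq_Nil:
  "first_passage d s v \<Longrightarrow> first_passage d s (v @ u) \<Longrightarrow> u = []"
  by (induction d s v rule: first_passage.induct) auto

text \<open>
  A walk that ends at or beyond the target has passed through the target itself, because it climbs
  by single steps.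
\<close>

lemma first_passage_prefix_exists:
  "s + d * count_list w False \<le> count_list w True \<Longrightarrow> \<exists>m\<le>length w. first_passage d s (take m w)"
proof (induction d s w rule: first_passage.induct)
  case (2 d c w)
  show ?case by (intro exI[of _ 0]) auto
next
  case (3 d s c w)
  then obtain m where "m \<le> length w" "first_passage d (if c then s else Suc s + d) (take m w)"
    by (auto split: if_splits)
  then show ?case by (intro exI[of _ "Suc m"]) auto
qed auto

lemma length_eq_count_list_bool: "length w = count_list w True + count_list w False"
  by (induction w) auto

definition first_passage_words :: "nat \<Rightarrow> nat \<Rightarrow> nat \<Rightarrow> bool list set" where
  "first_passage_words d s k = {w. first_passage d s w \<and> count_list w False = k}"

lemma first_passage_words_length:
  "w \<in> first_passage_words d s k \<Longrightarrow> length w = s + d * k + k"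
  by (auto simp: first_passage_words_def length_eq_count_list_bool first_passage_count)

lemma finite_first_passage_words [simp]: "finite (first_passage_words d s k)"
  by (rule finite_subset[OF _ finite_lists_length_eq[of UNIV "s + d * k + k"]])
     (auto dest: first_passage_words_length)

lemma first_passage_words_0: "first_passage_words d 0 k = (if k = 0 then {[]} else {})"
  by (auto simp: first_passage_words_def)

lemma first_passage_words_Suc_0:
  "first_passage_words d (Suc s) 0 = (#) True ` first_passage_words d s 0"
proof -
  have "w \<in> first_passage_words d (Suc s) 0 \<longleftrightarrow> w \<in> (#) True ` first_passage_words d s 0" for w
    by (cases w) (auto simp: first_passage_words_def)
  then show ?thesis by blast
qed

lemma first_passage_words_Suc_Suc:
  "first_passage_words d (Suc s) (Suc k) =
     (#) True ` first_passage_words d s (Suc k) \<union> (#) False ` first_passage_words d (Suc s + d) k"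
  (is "?L = ?R")
proof -
  have "w \<in> ?L \<longleftrightarrow> w \<in> ?R" for w
    by (cases w) (auto simp: first_passage_words_def)
  then show ?thesis by blast
qed

lemma card_first_passage_words_Suc_0:
  "card (first_passage_words d (Suc s) 0) = card (first_passage_words d s 0)"
  by (simp add: first_passage_words_Suc_0 card_image)

lemma card_first_passage_words_Suc_Suc:
  "card (first_passage_words d (Suc s) (Suc k)) =
     card (first_passage_words d s (Suc k)) + card (first_passage_words d (Suc s + d) k)"
  unfolding first_passage_words_Suc_Suc
  by (subst card_Un_disjoint) (auto simp: card_image)

lemma card_first_passage_words_no_black: "card (first_passage_words d s 0) = 1"
  by (induction s) (auto simp: first_passage_words_0 card_first_passage_words_Suc_0)

text \<open>
  Both sides satisfy the recurrence obtained by splitting off the first draw, which is either red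
  and leaves distance \<open>s - 1\<close>, or black and leaves distance \<open>s + d\<close> with one black draw fewer. After
  cancelling factorials, this is the identity
  \<open>(d k + s) (s - 1) + k (s + d) = s (s + (d + 1) k - 1)\<close>. For \<open>s = k = 0\<close> the formula fails: the
  empty word is counted on the left, while the factor \<open>s\<close> annihilates the right.
\<close>

lemma card_first_passage_words:
  assumes "s + k > 0"
  shows "card (first_passage_words d s k) * (fact k * fact (d * k + s)) =
           s * (fact (s + d * k + k - 1) :: nat)"
  using assms
proof (induction "s + d * k + k" arbitrary: s k rule: less_induct)
  case less
  consider "s = 0" "k > 0" | s' where "s = Suc s'" "k = 0" | s' k' where "s = Suc s'" "k = Suc k'"
    using less.prems by (cases s; cases k) auto
  then show ?case
  proof cases
    case 1
    then show ?thesis by (simp add: first_passage_words_0)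
  next
    case 2
    then show ?thesis by (simp add: card_first_passage_words_no_black)
  next
    case 3
    define n where "n = s' + d * k + k'"
    have red: "card (first_passage_words d s' k) * (fact k * fact (d * k + s')) = s' * fact n"
      using less.hyps[of s' k] 3 by (simp add: n_def)
    have black: "card (first_passage_words d (s + d) k') * (fact k' * fact (d * k + s)) =
                   (s + d) * fact n"
      using less.hyps[of "s + d" k'] 3 by (simp add: n_def algebra_simps)
    have split: "card (first_passage_words d s k) =
        card (first_passage_words d s' k) + card (first_passage_words d (s + d) k')"
      using 3 by (simp add: card_first_passage_words_Suc_Suc)
    \<comment> \<open>These factors bring both summands to the common denominator of the claim.\<close>
    have f1: "(fact (d * k + s) :: nat) = (d * k + s) * fact (d * k + s')"
      unfolding \<open>s = Suc s'\<close> add_Suc_right fact_Suc of_nat_id ..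
    have f2: "(fact k :: nat) = k * fact k'"
      unfolding \<open>k = Suc k'\<close> fact_Suc of_nat_id ..
    have "card (first_passage_words d s k) * (fact k * fact (d * k + s)) =
        card (first_passage_words d s' k) * (fact k * ((d * k + s) * fact (d * k + s')))
        + card (first_passage_words d (s + d) k') * ((k * fact k') * fact (d * k + s))"
      unfolding split f1[symmetric] f2[symmetric] by (rule distrib_right)
    also have "\<dots> =
        (d * k + s) * (card (first_passage_words d s' k) * (fact k * fact (d * k + s')))
        + k * (card (first_passage_words d (s + d) k') * (fact k' * fact (d * k + s)))"
      by (simp only: mult_ac)
    also have "\<dots> = ((d * k + s) * s' + k * (s + d)) * fact n"
      unfolding red black by (simp only: distrib_right mult.assoc)
    also have "(d * k + s) * s' + k * (s + d) = s * Suc n"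
      using 3 by (simp add: n_def algebra_simps)
    also have "s * Suc n * fact n = s * fact (Suc n)"
      by (simp only: fact_Suc of_nat_id mult.assoc)
    also have "Suc n = s + d * k + k - 1"
      using 3 by (simp add: n_def)
    finally show ?thesis .
  qed
qed

section \<open>Exchangeability of the draws\<close>

lemma red_balls_eq_count_list:
  "red_balls r c n = r + count_list (map c [0..<n]) True"
  by (induction n) auto

definition (in polya_urn) cylinder :: "bool list \<Rightarrow> 'a set" where
  "cylinder w = {\<omega> \<in> space M. map (\<lambda>i. D i \<omega>) [0..<length w] = w}"

lemma (in polya_urn) cylinder_eq:
  "cylinder w = {\<omega> \<in> space M. \<forall>i<length w. D i \<omega> = w ! i}"
proof -
  have "map (\<lambda>i. D i \<omega>) [0..<length w] = w \<longleftrightarrow> (\<forall>i<length w. D i \<omega> = w ! i)" for \<omega>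
    unfolding list_eq_iff_nth_eq[of "map (\<lambda>i. D i \<omega>) [0..<length w]" w] by simp
  then show ?thesis unfolding cylinder_def by blast
qed

lemma (in polya_urn) sets_cylinder [simp]: "cylinder w \<in> sets M"
proof -
  have "D i -` {x} \<inter> space M \<in> sets M" for i x
    by (rule measurable_sets[OF measurable_draw]) simp
  moreover have "D i -` {x} \<inter> space M = {\<omega> \<in> space M. D i \<omega> = x}" for i x
    by blast
  ultimately have draw_sets: "{\<omega> \<in> space M. D i \<omega> = x} \<in> sets M" for i x
    by metis
  have "{\<omega> \<in> space M. \<forall>i\<in>{..<length w}. D i \<omega> = w ! i} \<in> sets M"
    by (rule sets.sets_Collect_finite_All[OF draw_sets finite_lessThan])
  then show ?thesis unfolding cylinder_eq Ball_def lessThan_iff .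
qed

text \<open>
  The \<open>i\<close>-th red draw multiplies the numerator by \<open>r + i - 1\<close>, the \<open>i\<close>-th black draw by \<open>b + i - 1\<close>, and
  the \<open>i\<close>-th draw of any colour multiplies the denominator by \<open>r + b + i - 1\<close>, whatever the order of
  the colours.
\<close>

lemma (in polya_urn) prob_cylinder:
  "prob (cylinder w) =
     pochhammer (real r) (count_list w True) * pochhammer (real b) (count_list w False)
       / pochhammer (real (r + b)) (length w)"
proof (induction w rule: rev_induct)
  case Nil
  show ?case by (simp add: cylinder_eq prob_space)
next
  case (snoc c w)
  define n where "n = length w"
  define total where "total = real (n + r + b)"
  have total_pos: "total > 0" using red_pos by (simp add: total_def)
  \<comment> \<open>The urn never runs out of a colour, so every history has positive probability and may be
    conditioned on.\<close>
  have pos: "prob (cylinder w) > 0"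
    unfolding snoc.IH using red_pos black_pos
    by (intro divide_pos_pos mult_pos_pos pochhammer_pos) auto
  have cond: "\<P>(\<omega> in M. D n \<omega> \<bar> \<forall>i<n. D i \<omega> = w ! i) = (r + count_list w True) / total"
  proof -
    have "map ((!) w) [0..<n] = w" by (simp add: n_def map_nth)
    then show ?thesis
      using draw[of n "(!) w"] pos
      by (simp add: n_def total_def cylinder_eq red_fraction_def red_balls_eq_count_list)
  qed
  have W: "cylinder w = {\<omega> \<in> space M. \<forall>i<n. D i \<omega> = w ! i}"
    unfolding cylinder_eq n_def ..
  have snoc_eq: "cylinder (w @ [x]) = {\<omega> \<in> space M. D n \<omega> = x \<and> (\<forall>i<n. D i \<omega> = w ! i)}" for x
    unfolding cylinder_eq n_def
    by (simp add: All_less_Suc nth_append cong: conj_cong)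
  have T: "cylinder (w @ [True]) = {\<omega> \<in> space M. D n \<omega> \<and> (\<forall>i<n. D i \<omega> = w ! i)}"
    by (simp add: snoc_eq)
  have F: "cylinder (w @ [False]) = cylinder w - cylinder (w @ [True])"
    and sub: "cylinder (w @ [True]) \<subseteq> cylinder w"
    unfolding snoc_eq W by blast+
  have red: "prob (cylinder (w @ [True])) =
      prob (cylinder w) * ((r + count_list w True) / total)"
    using cond pos unfolding cond_prob_def T[symmetric] W[symmetric] by (simp add: field_simps)
  have black: "prob (cylinder (w @ [False])) =
      prob (cylinder w) * ((b + count_list w False) / total)"
  proof -
    have "prob (cylinder (w @ [False])) = prob (cylinder w) - prob (cylinder (w @ [True]))"
      unfolding F using sub by (intro finite_measure_Diff) auto
    also have "\<dots> = prob (cylinder w) * (1 - (r + count_list w True) / total)"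
      unfolding red by (simp add: algebra_simps)
    also have "1 - (r + count_list w True) / total = (b + count_list w False) / total"
      using total_pos length_eq_count_list_bool[of w]
      by (simp add: total_def n_def field_simps)
    finally show ?thesis .
  qed
  have "pochhammer (real (r + b)) (length (w @ [c])) =
      pochhammer (real (r + b)) (length w) * total"
    by (simp add: pochhammer_Suc total_def n_def add_ac)
  with red black snoc.IH show ?case
    by (cases c) (simp_all add: pochhammer_Suc del: length_append of_nat_add)
qed

section \<open>Exceeding the initial fraction\<close>

text \<open>
  The supremum of an unbounded family of reals is a junk value; here all fractions are at most one.
\<close>

lemma sup_red_fraction_gt_iff:
  "sup_red_fraction r b c > x \<longleftrightarrow> (\<exists>n. red_fraction r b c n > x)"
proof -
  have "red_fraction r b c n \<le> 1" for n
  proof -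
    have "count_list (map c [0..<n]) True \<le> n"
      using count_le_length[of "map c [0..<n]" True] by simp
    then show ?thesis
      by (auto simp: red_fraction_def red_balls_eq_count_list divide_le_eq_1)
  qed
  then have "bdd_above (range (red_fraction r b c))" by (intro bdd_aboveI2)
  then show ?thesis
    unfolding sup_red_fraction_def by (subst less_cSUP_iff) auto
qed

text \<open>
  Cross-multiplying, \<open>(d + j) (d + 1) > d (j + k + d + 1)\<close> simplifies to \<open>j > d k\<close>, where \<open>j\<close> and \<open>k\<close>
  are the numbers of red and black draws: the \<open>d\<close> red balls at the start balance the black one.
\<close>

lemma red_fraction_gt_iff:
  "red_fraction d 1 c n > real d / real (Suc d) \<longleftrightarrow>
         1 + d * count_list (map c [0..<n]) False \<le> count_list (map c [0..<n]) True"
proof -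
  define j k where "j = count_list (map c [0..<n]) True" and "k = count_list (map c [0..<n]) False"
  have n: "n = j + k"
    using length_eq_count_list_bool[of "map c [0..<n]"] by (simp add: j_def k_def)
  have "red_fraction d 1 c n > real d / real (Suc d) \<longleftrightarrow>
        real d * real (n + d + 1) < real (d + j) * real (Suc d)"
    unfolding red_fraction_def red_balls_eq_count_list j_def[symmetric] by (simp add: field_simps)
  also have "\<dots> \<longleftrightarrow> d * (n + d + 1) < (d + j) * Suc d"
    by (metis of_nat_less_iff of_nat_mult)
  also have "\<dots> \<longleftrightarrow> 1 + d * k \<le> j"
    unfolding n by (auto simp: algebra_simps)
  finally show ?thesis unfolding j_def k_def .
qed

text \<open>
  The first passage is recorded by its number \<open>k\<close> of black draws, which determines its time.
\<close>

lemma sup_red_fraction_gt_iff_first_passage: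
  "sup_red_fraction d 1 c > real d / real (Suc d) \<longleftrightarrow>
         (\<exists>k. map c [0..<1 + d * k + k] \<in> first_passage_words d 1 k)"
proof -
  have "(\<exists>n. 1 + d * count_list (map c [0..<n]) False \<le> count_list (map c [0..<n]) True) \<longleftrightarrow>
        (\<exists>n. first_passage d 1 (map c [0..<n]))" (is "?A \<longleftrightarrow> ?B")
  proof
    assume ?A
    then obtain n where
      "1 + d * count_list (map c [0..<n]) False \<le> count_list (map c [0..<n]) True" ..
    from first_passage_prefix_exists[OF this]
    obtain m where "m \<le> n" "first_passage d 1 (take m (map c [0..<n]))" by auto
    then have "first_passage d 1 (map c [0..<m])" by (simp add: take_map)
    then show ?B ..
  next
    assume ?B
    then show ?A using eq_refl[OF first_passage_count[symmetric]] by blast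
  qed
  also have "\<dots> \<longleftrightarrow> (\<exists>k. map c [0..<1 + d * k + k] \<in> first_passage_words d 1 k)" (is "_ \<longleftrightarrow> ?C")
  proof
    assume ?B
    then obtain n where n: "first_passage d 1 (map c [0..<n])" by blast
    define k where "k = count_list (map c [0..<n]) False"
    have w: "map c [0..<n] \<in> first_passage_words d 1 k"
      using n by (simp add: first_passage_words_def k_def)
    from first_passage_words_length[OF this] have "n = 1 + d * k + k" by simp
    then show ?C using w by blast
  next
    assume ?C
    then show ?B unfolding first_passage_words_def by blast
  qed
  finally show ?thesis
    by (simp only: sup_red_fraction_gt_iff red_fraction_gt_iff)
qed

section \<open>The law of the first passage\<close>

lemma (in polya_urn) cylinder_first_passage_word:
  assumes "w \<in> first_passage_words d s k"
  shows "cylinder w = {\<omega> \<in> space M. map (\<lambda>i. D i \<omega>) [0..<s + d * k + k] = w}"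
  unfolding cylinder_def first_passage_words_length[OF assms] ..

lemma (in polya_urn) first_passage_event_eq_Union_cylinder:
  "{\<omega> \<in> space M. map (\<lambda>i. D i \<omega>) [0..<s + d * k + k] \<in> first_passage_words d s k} =
     (\<Union>w\<in>first_passage_words d s k. cylinder w)"
proof -
  have "{\<omega> \<in> space M. map (\<lambda>i. D i \<omega>) [0..<s + d * k + k] \<in> first_passage_words d s k} =
      (\<Union>w\<in>first_passage_words d s k. {\<omega> \<in> space M. map (\<lambda>i. D i \<omega>) [0..<s + d * k + k] = w})"
    by blast
  also have "\<dots> = (\<Union>w\<in>first_passage_words d s k. cylinder w)"
    by (rule SUP_cong[OF refl cylinder_first_passage_word[symmetric]])
  finally show ?thesis .
qed

lemma (in polya_urn) prob_first_passage:
  "prob {\<omega> \<in> space M. map (\<lambda>i. D i \<omega>) [0..<s + d * k + k] \<in> first_passage_words d s k} =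
     card (first_passage_words d s k) *
     (pochhammer (real r) (s + d * k) * pochhammer (real b) k
        / pochhammer (real (r + b)) (s + d * k + k))" (is "prob ?E = _ * ?p")
proof -
  let ?W = "first_passage_words d s k"
  have disj: "disjoint_family_on cylinder ?W"
    unfolding disjoint_family_on_def
  proof (intro ballI impI)
    fix v w assume "v \<in> ?W" "w \<in> ?W" "v \<noteq> w"
    then show "cylinder v \<inter> cylinder w = {}"
      unfolding \<open>v \<in> ?W\<close>[THEN cylinder_first_passage_word]
        \<open>w \<in> ?W\<close>[THEN cylinder_first_passage_word] by blast
  qed
  have p: "prob (cylinder w) = ?p" if "w \<in> ?W" for w
  proof -
    have "count_list w False = k" "count_list w True = s + d * k"
      using that first_passage_count[of d s w] by (simp_all add: first_passage_words_def)
    then show ?thesis by (simp only: prob_cylinder first_passage_words_length[OF that])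
  qed
  have "prob ?E = (\<Sum>w\<in>?W. prob (cylinder w))"
    unfolding first_passage_event_eq_Union_cylinder
    by (intro finite_measure_finite_Union disj) auto
  also have "\<dots> = (\<Sum>w\<in>?W. ?p)"
    by (rule sum.cong[OF refl p])
  also have "\<dots> = card ?W * ?p"
    by (rule sum_constant)
  finally show ?thesis .
qed

lemma first_passage_time_unique:
  assumes "map c [0..<n] \<in> first_passage_words d s k"
    and "map c [0..<m] \<in> first_passage_words d s l" and "n \<le> m"
  shows "k = l"
proof -
  have "[0..<m] = [0..<n] @ [n..<m]"
    using upt_add_eq_append[of 0 n "m - n"] \<open>n \<le> m\<close> by simp
  then have "map c [0..<m] = map c [0..<n] @ map c [n..<m]"
    by (simp only: map_append)
  moreover from this have "map c [n..<m] = []"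
    using first_passage_append_eq_Nil[of d s "map c [0..<n]" "map c [n..<m]"] assms(1,2)
    by (simp only: first_passage_words_def mem_Collect_eq)
  ultimately have "map c [0..<m] = map c [0..<n]"
    by (simp only: append_Nil2)
  then show ?thesis
    using assms(1,2) by (simp only: first_passage_words_def mem_Collect_eq)
qed

lemma disjoint_family_first_passage:
  "disjoint_family (\<lambda>k. {\<omega> \<in> A. map (f \<omega>) [0..<s + d * k + k] \<in> first_passage_words d s k})"
  unfolding disjoint_family_on_def
proof (intro ballI impI)
  fix k l :: nat
  assume "k \<noteq> l"
  have "\<not> (map c [0..<s + d * k + k] \<in> first_passage_words d s k \<and>
            map c [0..<s + d * l + l] \<in> first_passage_words d s l)" for c
    using first_passage_time_unique[of c "s + d * k + k" d s k "s + d * l + l" l]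
      first_passage_time_unique[of c "s + d * l + l" d s l "s + d * k + k" k]
      nat_le_linear[of "s + d * k + k" "s + d * l + l"] \<open>k \<noteq> l\<close> by blast
  then show "{\<omega> \<in> A. map (f \<omega>) [0..<s + d * k + k] \<in> first_passage_words d s k} \<inter>
      {\<omega> \<in> A. map (f \<omega>) [0..<s + d * l + l] \<in> first_passage_words d s l} = {}"
    by blast
qed

lemma pochhammer_of_nat_eq_fact:
  "pochhammer (real (Suc a)) n = fact (a + n) / fact a"
  using pochhammer_product'[of "1 :: real" a n] by (simp add: pochhammer_fact[symmetric])

theorem proposition5p3:
  fixes M :: "'a measure" and D :: "nat \<Rightarrow> 'a \<Rightarrow> bool" and t :: nat
  assumes "t \<ge> 2" and "polya_urn M D (t - 1) 1"
  defines "a \<equiv> (\<lambda>n. fact (n * t) / fact (n * t - n + 1) *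
                     (fact ((n + 1) * (t - 1)) / fact ((n + 1) * t)) :: real)"
  shows "summable a \<and>
    \<P>(\<omega> in M. sup_red_fraction (t - 1) 1 (\<lambda>n. D n \<omega>) > (real t - 1) / real t)
      = (real t - 1) * (\<Sum>n. a n)"
proof -
  interpret polya_urn M D "t - 1" 1 by (rule assms(2))
  define m where "m = t - 2"
  have t: "t = Suc (Suc m)" using assms(1) by (simp add: m_def)
  define d where "d = t - 1"
  have d: "d = Suc m" "t = Suc d" by (simp_all add: d_def t)
  define E where "E k = {\<omega> \<in> space M.
      map (\<lambda>i. D i \<omega>) [0..<1 + d * k + k] \<in> first_passage_words d 1 k}" for k
  have E_sets: "range E \<subseteq> sets M"
    unfolding E_def first_passage_event_eq_Union_cylinder by (auto intro!: sets.finite_UN)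
  have ratio: "(real t - 1) / real t = real d / real (Suc d)"
    by (simp add: d)
  have "{\<omega> \<in> space M. sup_red_fraction (t - 1) 1 (\<lambda>n. D n \<omega>) > (real t - 1) / real t} = (\<Union>k. E k)"
    unfolding ratio d_def[symmetric] sup_red_fraction_gt_iff_first_passage E_def by blast
  moreover have "prob (E k) = real d * a k" for k
  proof -
    define N where "N = card (first_passage_words d 1 k)"
    define A where "A = (k + 1) * (t - 1)"
    define B where "B = (k + 1) * t"
    have "real (N * (fact k * fact (d * k + 1))) = real (fact (d * k + k))"
      using card_first_passage_words[of 1 k d] by (simp add: N_def)
    then have N: "real N = fact (d * k + k) / (fact k * fact (d * k + 1))"
      by (simp only: of_nat_mult of_nat_fact eq_divide_eq mult_eq_0_iff fact_nonzero
          simp_thms if_False if_True)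
    have idx: "m + (1 + d * k) = A" "Suc m + (1 + d * k + k) = B"
      by (simp_all add: A_def B_def d)
    have red: "pochhammer (real d) (1 + d * k) = fact A / fact m"
      unfolding d(1) using pochhammer_of_nat_eq_fact[of m "1 + d * k"] idx by (simp only: d(1))
    have black: "pochhammer (real 1) k = fact k"
      using pochhammer_of_nat_eq_fact[of 0 k] by simp
    have total: "pochhammer (real (d + 1)) (1 + d * k + k) = fact B / fact d"
      using pochhammer_of_nat_eq_fact[of d "1 + d * k + k"] idx(2) by (simp only: d(1) Suc_eq_plus1)
    have dm: "(fact d :: real) = real d * fact m"
      unfolding d(1) by (rule fact_Suc)
    have "prob (E k) = real N * (pochhammer (real d) (1 + d * k) * pochhammer (real 1) k
        / pochhammer (real (d + 1)) (1 + d * k + k))"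
      unfolding E_def prob_first_passage N_def d_def ..
    also have "\<dots> = fact (d * k + k) / (fact k * fact (d * k + 1)) *
        (fact A / fact m * fact k / (fact B / (real d * fact m)))"
      unfolding N red black total dm ..
    also have "\<dots> = real d * (fact (d * k + k) / fact (d * k + 1) * (fact A / fact B))"
      by (simp only: times_divide_eq_left times_divide_eq_right divide_divide_eq_left
          divide_divide_eq_right) (simp add: divide_simps del: fact_Suc)
    also have "d * k + k = k * t" by (simp add: d)
    also have "d * k + 1 = k * t - k + 1" by (simp add: d)
    finally show ?thesis unfolding a_def A_def B_def .
  qed
  moreover have "(\<lambda>k. prob (E k)) sums prob (\<Union>k. E k)"
    using E_sets unfolding E_def
    by (intro finite_measure_UNION disjoint_family_first_passage)
  ultimately have sums: "(\<lambda>k. real d * a k) sums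
      \<P>(\<omega> in M. sup_red_fraction (t - 1) 1 (\<lambda>n. D n \<omega>) > (real t - 1) / real t)"
    by simp
  then have "summable a"
    by (metis d(1) nat.distinct(1) of_nat_eq_0_iff sums_summable summable_cmult_iff)
  moreover have "real d = real t - 1" by (simp add: d)
  ultimately show ?thesis
    using sums_unique[OF sums] by (simp add: suminf_mult)
qed

end
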